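(* Let $k$ be a field with $\mathrm{char}\,k\ne3$ and let $M\supset k$ be a Hilbertian field. Then for a fixed $a\in M$ with $a(4a+27)\neq0$ there exist infinitely many $b\in M$ such that $\mathrm{Spl}_M(X^3+aX+a)=\mathrm{Spl}_M(X^3+bX+b)$.
   Context: $\mathrm{Spl}_M f$ denotes the splitting field of $f$ over $M$ in a fixed algebraic closure of $M$. The discriminant of $X^3+aX+a$ is $-a^2(4a+27)$. *)

theory Defs
  imports
    "HOL-Algebra.Algebraic_Closure_Type"
    "HOL-Algebra.Generated_Fields"
    "HOL-Computational_Algebra.Fraction_Field"
    "HOL-Library.Poly_Mapping"
begin

text \<open>
  Hilbertian fields in the sense of Fried and Jarden: every separable Hilbert subset of
  \<open>K\<^sup>r\<close> is nonempty, for all \<open>r\<close>. In characteristic 0 all irreducible polynomials are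
  separable; in positive characteristic, dropping separability would give a more restrictive
  notion of Hilbertian field.

  All numbers \<open>r\<close> of parameters are treated at once by using the indeterminates
  \<open>T\<^sub>0, T\<^sub>1, \<dots>\<close>: finitely many polynomials over \<open>K(T\<^sub>0, T\<^sub>1, \<dots>)\<close> involve only
  finitely many of them, and irreducibility and separability of a polynomial over
  \<open>K(T\<^sub>0, \<dots>, T\<^sub>r\<^sub>-\<^sub>1)\<close> do not change under adjoining further indeterminates. A parameter
  tuple is accordingly a function on \<open>nat\<close>, of which only finitely many values matter.
\<close>

type_synonym 'a mpoly = "(nat \<Rightarrow>\<^sub>0 nat) \<Rightarrow>\<^sub>0 'a"

definition mpoly_eval :: "(nat \<Rightarrow> 'a::field) \<Rightarrow> 'a mpoly \<Rightarrow> 'a" where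
  "mpoly_eval t p =
     (\<Sum>m\<in>Poly_Mapping.keys p. Poly_Mapping.lookup p m *
        (\<Prod>i\<in>Poly_Mapping.keys m. t i ^ Poly_Mapping.lookup m i))"

text \<open>\<open>specializes_to t f h\<close>: the polynomial \<open>f(t, X)\<close> is defined (no denominator of a
  coefficient vanishes at \<open>t\<close>) and equals \<open>h\<close>.\<close>

definition specializes_to ::
  "(nat \<Rightarrow> 'a::field) \<Rightarrow> 'a mpoly fract poly \<Rightarrow> 'a poly \<Rightarrow> bool" where
  "specializes_to t f h \<longleftrightarrow>
     (\<forall>n. \<exists>p q. mpoly_eval t q \<noteq> 0 \<and> coeff f n = Fract p q \<and>
            coeff h n = mpoly_eval t p / mpoly_eval t q)"

definition hilbert_set ::
  "'a::field mpoly fract poly set \<Rightarrow> 'a mpoly \<Rightarrow> (nat \<Rightarrow> 'a) set" where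
  "hilbert_set F g =
     {t. mpoly_eval t g \<noteq> 0 \<and> (\<forall>f\<in>F. \<exists>h. specializes_to t f h \<and> irreducible h)}"

definition hilbertian :: "'a::field itself \<Rightarrow> bool" where
  "hilbertian _ \<longleftrightarrow>
     (\<forall>(F :: 'a mpoly fract poly set) (g :: 'a mpoly).
        finite F \<longrightarrow> (\<forall>f\<in>F. irreducible f \<and> coprime f (pderiv f)) \<longrightarrow> g \<noteq> 0 \<longrightarrow>
        hilbert_set F g \<noteq> {})"

text \<open>The fixed algebraic closure of the field \<open>'m\<close> is \<open>'m alg_closure\<close>, with embedding
  \<^const>\<open>to_ac\<close>.\<close>

definition Spl :: "'m::field poly \<Rightarrow> 'm alg_closure set" where
  "Spl f = generate_field ring_of_type_algebra
             (range to_ac \<union> {x. poly (map_poly to_ac f) x = 0})"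

end

theory Submission
  imports Defs
begin

text \<open>
  The form \<open>F(X, Z) = X\<^sup>3 + a X Z\<^sup>2 + a Z\<^sup>3\<close> is moved by \<open>PGL\<^sub>2(M)\<close>. Given \<open>t\<close> with \<open>F(t, 1) \<noteq> 0\<close>,
  substituting \<open>(X, Z) = (t Y + \<beta> W, Y + \<delta> W)\<close>, where \<open>(\<beta>, \<delta>) = (F\<^sub>Z(t, 1), -F\<^sub>X(t, 1))\<close>, kills the
  coefficient of \<open>Y\<^sup>2 W\<close> and has determinant \<open>-3 F(t, 1) \<noteq> 0\<close>. The coefficients of \<open>Y W\<^sup>2\<close> and
  \<open>W\<^sup>3\<close> are \<open>F(t, 1)\<close> times the Hessian \<open>3 a h\<close> and the cubic covariant \<open>a g\<close> of \<open>F\<close> at \<open>(t, 1)\<close>, so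
  scaling \<open>W\<close> by \<open>s = 3 h / g\<close> turns \<open>F\<close> into \<open>F(t, 1) (Y\<^sup>3 + b Y W\<^sup>2 + b W\<^sup>3)\<close> with
  \<open>b = 27 a h\<^sup>3 / g\<^sup>2\<close>. The roots of the two cubics then correspond under a Moebius transformation
  over \<open>M\<close>, which gives equal splitting fields. Each value of \<open>b\<close> is attained for only finitely
  many \<open>t\<close>, and \<open>M\<close> is infinite: over a field with \<open>q\<close> elements the nonzero polynomial \<open>T\<^sup>q - T\<close>
  vanishes at every point, so the Hilbert sets it cuts out are empty.
\<close>

section \<open>Hilbertian fields are infinite\<close>

text \<open>Multiplication by \<open>x \<noteq> 0\<close> permutes the nonzero elements; comparing
  their product before and after gives \<open>x ^ (q - 1) = 1\<close>.\<close>

lemma power_card_eq_same: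
  fixes x :: "'a::field"
  assumes "finite (UNIV :: 'a set)"
  shows "x ^ card (UNIV :: 'a set) = x"
proof (cases "x = 0")
  case True
  have "card (UNIV :: 'a set) \<noteq> 0" using assms by simp
  with True show ?thesis by simp
next
  case False
  let ?U = "UNIV - {0 :: 'a}"
  have "(\<Prod>y\<in>?U. y) = (\<Prod>y\<in>?U. x * y)"
    by (rule prod.reindex_bij_witness[of _ "\<lambda>y. x * y" "\<lambda>y. y / x"]) (use False in auto)
  also have "\<dots> = x ^ card ?U * (\<Prod>y\<in>?U. y)"
    by (simp add: prod.distrib)
  finally have "x ^ card ?U = 1"
    using assms by simp
  moreover have "Suc (card ?U) = card (UNIV :: 'a set)"
    using assms by (rule card_Suc_Diff1) auto
  ultimately show ?thesis by (metis mult_1_right power_Suc)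
qed

text \<open>Supplies the test polynomial in the first indeterminate; distinct exponents keep its two
  monomials from cancelling.\<close>

lemma mpoly_eval_diff_powers:
  fixes t :: "nat \<Rightarrow> 'a::field"
  assumes "m \<noteq> n"
  defines "p \<equiv> Poly_Mapping.single (Poly_Mapping.single 0 m) 1 -
                Poly_Mapping.single (Poly_Mapping.single 0 n) (1 :: 'a)"
  shows "p \<noteq> 0" and "mpoly_eval t p = t 0 ^ m - t 0 ^ n"
proof -
  let ?m = "Poly_Mapping.single 0 m :: nat \<Rightarrow>\<^sub>0 nat" and ?n = "Poly_Mapping.single 0 n :: nat \<Rightarrow>\<^sub>0 nat"
  have ne: "?m \<noteq> ?n"
    using assms(1) by (metis lookup_single_eq)
  have look: "Poly_Mapping.lookup p ?m = 1" "Poly_Mapping.lookup p ?n = -1"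
    using ne by (auto simp: p_def lookup_minus lookup_single_eq lookup_single_not_eq)
  then show "p \<noteq> 0" by auto
  have keys: "Poly_Mapping.keys p = {?m, ?n}"
  proof
    show "Poly_Mapping.keys p \<subseteq> {?m, ?n}"
      by (auto simp: p_def in_keys_iff lookup_minus lookup_single when_def split: if_splits)
    show "{?m, ?n} \<subseteq> Poly_Mapping.keys p"
      using look by (auto simp: in_keys_iff)
  qed
  \<comment> \<open>For \<open>k = 0\<close> the monomial is the zero mapping without keys, so the
    product is empty.\<close>
  have monom: "(\<Prod>i\<in>Poly_Mapping.keys (Poly_Mapping.single 0 k). t i ^ Poly_Mapping.lookup (Poly_Mapping.single 0 k) i)
      = t 0 ^ k" for k :: nat
    by (cases "k = 0") auto
  show "mpoly_eval t p = t 0 ^ m - t 0 ^ n"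
    unfolding mpoly_eval_def keys using ne look by (simp add: monom)
qed

lemma infinite_if_hilbertian:
  assumes "hilbertian TYPE('a::field)"
  shows "infinite (UNIV :: 'a set)"
proof
  assume fin: "finite (UNIV :: 'a set)"
  let ?g = "Poly_Mapping.single (Poly_Mapping.single 0 (card (UNIV :: 'a set))) 1 -
            Poly_Mapping.single (Poly_Mapping.single 0 1) 1 :: 'a mpoly"
  \<comment> \<open>Since 0 and 1 are distinct, the exponents in \<open>?g\<close> differ and
    \<open>?g\<close> is nonzero.\<close>
  have "card {0, 1 :: 'a} \<le> card (UNIV :: 'a set)"
    using fin by (intro card_mono) auto
  then have ne: "card (UNIV :: 'a set) \<noteq> 1" by auto
  \<comment> \<open>With no polynomial to keep irreducible, only the nonvanishing of
    \<open>?g\<close> is demanded.\<close>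
  have "hilbert_set {} ?g = {}"
    unfolding hilbert_set_def mpoly_eval_diff_powers(2)[OF ne]
    by (simp add: power_card_eq_same[OF fin])
  moreover have "hilbert_set {} ?g \<noteq> {}"
    using assms mpoly_eval_diff_powers(1)[OF ne] unfolding hilbertian_def by blast
  ultimately show False by contradiction
qed

section \<open>The characteristic of an extension field\<close>

lemma ring_hom_of_nat:
  fixes \<iota> :: "'k::field \<Rightarrow> 'm::field"
  assumes "\<iota> \<in> ring_hom ring_of_type_algebra ring_of_type_algebra"
  shows "\<iota> (of_nat n) = of_nat n"
proof -
  have add: "\<iota> (x + y) = \<iota> x + \<iota> y" and one: "\<iota> 1 = 1" for x y
    using assms by (auto simp: ring_hom_def ring_of_type_algebra_def)
  have "\<iota> 0 = 0" using add[of 0 0] by (metis add_0 add_cancel_right_right)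
  then show ?thesis by (induction n) (auto simp: add one)
qed

text \<open>Nonzero elements are units and so have nonzero images; hence an integer vanishes in one
  field exactly when it vanishes in the other.\<close>

lemma CHAR_eq_if_ring_hom:
  fixes \<iota> :: "'k::field \<Rightarrow> 'm::field"
  assumes "\<iota> \<in> ring_hom ring_of_type_algebra ring_of_type_algebra"
  shows "CHAR('m) = CHAR('k)"
proof (rule CHAR_eqI)
  have mult: "\<iota> (x * y) = \<iota> x * \<iota> y" and one: "\<iota> 1 = 1" for x y
    using assms by (auto simp: ring_hom_def ring_of_type_algebra_def)
  have zero: "\<iota> 0 = 0"
    using ring_hom_of_nat[OF assms, of 0] by simp
  show "of_nat CHAR('k) = (0 :: 'm)"
    using ring_hom_of_nat[OF assms, of "CHAR('k)"] zero by simp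
  fix n assume "of_nat n = (0 :: 'm)"
  then have "\<iota> (of_nat n) = 0" by (simp add: ring_hom_of_nat[OF assms])
  then have "of_nat n = (0 :: 'k)"
    using mult[of "of_nat n" "inverse (of_nat n)"] one by (metis mult_zero_left right_inverse zero_neq_one)
  then show "CHAR('k) dvd n" by (simp add: of_nat_eq_0_iff_char_dvd)
qed

section \<open>Splitting fields and Moebius maps over the base field\<close>

lemma generate_field_type_algebra_closed:
  fixes H :: "'a::field set"
  defines "E \<equiv> generate_field ring_of_type_algebra H"
  assumes "x \<in> E" "y \<in> E"
  shows "x + y \<in> E" "x * y \<in> E" "y \<noteq> 0 \<Longrightarrow> x / y \<in> E"
proof -
  interpret field "ring_of_type_algebra :: 'a ring" ..
  have ops: "x \<oplus>\<^bsub>ring_of_type_algebra\<^esub> y = x + y" "x \<otimes>\<^bsub>ring_of_type_algebra\<^esub> y = x * y"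
    "\<zero>\<^bsub>ring_of_type_algebra\<^esub> = (0 :: 'a)" for x y :: 'a
    by (simp_all add: ring_of_type_algebra_def)
  have mult: "x * y \<in> E" if "x \<in> E" "y \<in> E" for x y
    using generate_field.eng_mult[of x ring_of_type_algebra H y] that unfolding E_def ops .
  show "x + y \<in> E" "x * y \<in> E"
    using generate_field.eng_add[of x ring_of_type_algebra H y] mult assms unfolding E_def ops by auto
  show "x / y \<in> E" if "y \<noteq> 0"
  proof -
    have "inv\<^bsub>ring_of_type_algebra\<^esub> y = inverse y"
      using that by (intro comm_inv_char) (auto simp: ring_of_type_algebra_def)
    then have "inverse y \<in> E"
      using generate_field.m_inv[of y ring_of_type_algebra H] assms that unfolding E_def ops by simp
    then show ?thesis
      using mult assms by (simp add: divide_inverse)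
  qed
qed

lemma to_ac_in_Spl: "to_ac c \<in> Spl f"
  unfolding Spl_def by (rule generate_field.incl) auto

lemma root_in_Spl: "poly (map_poly to_ac f) x = 0 \<Longrightarrow> x \<in> Spl f"
  unfolding Spl_def by (rule generate_field.incl) auto

lemma Moebius_in_Spl:
  assumes "x \<in> Spl f" and "to_ac r * x + to_ac s \<noteq> 0"
  shows "(to_ac p * x + to_ac q) / (to_ac r * x + to_ac s) \<in> Spl f"
proof -
  note closed = generate_field_type_algebra_closed[where H = "range to_ac \<union> {x. poly (map_poly to_ac f) x = 0}",
      folded Spl_def]
  show ?thesis
    using assms by (intro closed to_ac_in_Spl)
qed

text \<open>A splitting field is the least subfield containing the constants and the roots, so it
  suffices to reach each root of \<open>f1\<close> rationally from a root of
  \<open>f2\<close>.\<close>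

lemma Spl_subset_if_roots_Moebius:
  fixes f1 f2 :: "'m::field poly"
  assumes "\<And>y. poly (map_poly to_ac f1) y = 0 \<Longrightarrow>
             \<exists>x p q r s. poly (map_poly to_ac f2) x = 0 \<and> to_ac r * x + to_ac s \<noteq> 0 \<and>
               y = (to_ac p * x + to_ac q) / (to_ac r * x + to_ac s)"
  shows "Spl f1 \<subseteq> Spl f2"
proof -
  interpret field "ring_of_type_algebra :: 'm alg_closure ring" ..
  have "{y. poly (map_poly to_ac f1) y = 0} \<subseteq> Spl f2"
    using assms by (blast intro: Moebius_in_Spl root_in_Spl)
  moreover have "subfield (Spl f2) ring_of_type_algebra"
    unfolding Spl_def by (rule generate_field_is_subfield) (simp add: ring_of_type_algebra_def)
  ultimately show ?thesis
    unfolding Spl_def[of f1]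
    by (intro generate_field_min_subfield1) (auto simp: to_ac_in_Spl ring_of_type_algebra_def)
qed

section \<open>Covariants and the transformation of the cubic form\<close>

definition hess :: "'a::field \<Rightarrow> 'a \<Rightarrow> 'a" where
  "hess a t = 3 * t^2 + 9 * t - a"

definition covar :: "'a::field \<Rightarrow> 'a \<Rightarrow> 'a" where
  "covar a t = - 27 * t^3 + 18 * a * t^2 + 27 * a * t + 27 * a + 2 * a^2"

definition param :: "'a::field \<Rightarrow> 'a \<Rightarrow> 'a" where
  "param a t = 27 * a * hess a t ^ 3 / covar a t ^ 2"

lemma cubic_form_substitution:
  fixes a t y :: "'a::field"
  assumes "covar a t \<noteq> 0"
  defines "s \<equiv> 3 * hess a t / covar a t"
  defines "u \<equiv> t * y + s * (2 * a * t + 3 * a)" and "v \<equiv> y - s * (3 * t^2 + a)"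
  shows "u^3 + a * u * v^2 + a * v^3 = (t^3 + a * t + a) * (y^3 + param a t * y + param a t)"
proof -
  have "u^3 + a * u * v^2 + a * v^3 =
      (t^3 + a * t + a) * (y^3 + s^2 * (3 * a * hess a t) * y + s^3 * (a * covar a t))"
    unfolding u_def v_def hess_def covar_def
    by (simp add: algebra_simps power2_eq_square power3_eq_cube)
  \<comment> \<open>The identity above holds for any \<open>s\<close>; the chosen \<open>s\<close>
    is the one that makes the last two coefficients agree.\<close>
  moreover have "s^2 * (3 * a * hess a t) = param a t" "s^3 * (a * covar a t) = param a t"
    using assms(1) by (simp_all add: s_def param_def power2_eq_square power3_eq_cube field_simps)
  ultimately show ?thesis by simp
qed

lemma to_ac_param:
  "to_ac (hess a t) = hess (to_ac a) (to_ac t)" "to_ac (covar a t) = covar (to_ac a) (to_ac t)"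
  "to_ac (param a t) = param (to_ac a) (to_ac t)"
  by (simp_all add: param_def hess_def covar_def)

lemma poly_cubic: "poly (map_poly to_ac [:c, c, 0, 1:]) x = x^3 + to_ac c * x + to_ac c"
  by (simp add: map_poly_pCons algebra_simps power3_eq_cube)

lemma Spl_param_eq:
  fixes a t :: "'m::field"
  assumes three: "(3 :: 'm) \<noteq> 0" and F: "t^3 + a * t + a \<noteq> 0"
    and h: "hess a t \<noteq> 0" and g: "covar a t \<noteq> 0"
  shows "Spl [:a, a, 0, 1:] = Spl [:param a t, param a t, 0, 1:]"
proof -
  define b where "b = param a t"
  define s where "s = 3 * hess a t / covar a t"
  define \<beta> where "\<beta> = s * (2 * a * t + 3 * a)"
  define \<delta> where "\<delta> = - s * (3 * t^2 + a)"
  have "s \<noteq> 0" using three h g by (simp add: s_def)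
  have det: "\<beta> - t * \<delta> \<noteq> 0"
  proof -
    \<comment> \<open>Euler's relation \<open>X F_X + Z F_Z = 3 F\<close> at
      \<open>(t, 1)\<close>.\<close>
    have "\<beta> - t * \<delta> = s * 3 * (t^3 + a * t + a)"
      unfolding \<beta>_def \<delta>_def
      by (simp add: algebra_simps power2_eq_square power3_eq_cube)
    then show ?thesis using three F \<open>s \<noteq> 0\<close> by simp
  qed
  have det': "to_ac \<beta> - to_ac t * to_ac \<delta> \<noteq> 0"
    using det by (metis to_ac_diff to_ac_eq_0_iff to_ac_mult)
  have F': "to_ac t ^ 3 + to_ac a * to_ac t + to_ac a \<noteq> 0"
    using F by (metis to_ac_add to_ac_eq_0_iff to_ac_mult to_ac_power)
  have subst: "(to_ac t * y + to_ac \<beta>)^3 + to_ac a * (to_ac t * y + to_ac \<beta>) * (y + to_ac \<delta>)^2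
        + to_ac a * (y + to_ac \<delta>)^3
      = (to_ac t ^ 3 + to_ac a * to_ac t + to_ac a) * (y^3 + to_ac b * y + to_ac b)" for y
    using cubic_form_substitution[of "to_ac a" "to_ac t" y] g
    by (simp add: b_def \<beta>_def \<delta>_def s_def flip: to_ac_param)
  have "Spl [:b, b, 0, 1:] \<subseteq> Spl [:a, a, 0, 1:]"
  proof (rule Spl_subset_if_roots_Moebius)
    fix y assume "poly (map_poly to_ac [:b, b, 0, 1:]) y = 0"
    then have y: "y^3 + to_ac b * y + to_ac b = 0" unfolding poly_cubic .
    \<comment> \<open>If the second coordinate vanished, the form would reduce to the cube of the
      first, so both coordinates would vanish, against the nonzero determinant.\<close>
    have Z: "y + to_ac \<delta> \<noteq> 0"
    proof
      assume Z: "y + to_ac \<delta> = 0"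
      then have "to_ac t * y + to_ac \<beta> = 0" using subst[of y] y by simp
      moreover have "y = - to_ac \<delta>" using Z by (simp add: eq_neg_iff_add_eq_0)
      ultimately have "to_ac \<beta> - to_ac t * to_ac \<delta> = 0" by simp
      with det' show False by contradiction
    qed
    define x where "x = (to_ac t * y + to_ac \<beta>) / (y + to_ac \<delta>)"
    have xZ: "x * (y + to_ac \<delta>) = to_ac t * y + to_ac \<beta>" using Z by (simp add: x_def)
    have "(x^3 + to_ac a * x + to_ac a) * (y + to_ac \<delta>)^3 =
        (to_ac t ^ 3 + to_ac a * to_ac t + to_ac a) * (y^3 + to_ac b * y + to_ac b)"
      unfolding subst[symmetric] xZ[symmetric] by (simp add: algebra_simps power2_eq_square power3_eq_cube)
    then have root: "x^3 + to_ac a * x + to_ac a = 0" using Z y by simp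
    \<comment> \<open>The point \<open>t\<close> corresponds to \<open>y\<close> at infinity; away
      from it the Moebius map can be inverted.\<close>
    have "x \<noteq> to_ac t" using root F' by auto
    then have "y = (to_ac (- \<delta>) * x + to_ac \<beta>) / (to_ac 1 * x + to_ac (- t))"
      using xZ by (simp add: field_simps)
    moreover have "to_ac 1 * x + to_ac (- t) \<noteq> 0" using \<open>x \<noteq> to_ac t\<close> by simp
    ultimately show "\<exists>x p q r s. poly (map_poly to_ac [:a, a, 0, 1:]) x = 0 \<and>
        to_ac r * x + to_ac s \<noteq> 0 \<and> y = (to_ac p * x + to_ac q) / (to_ac r * x + to_ac s)"
      using root unfolding poly_cubic by blast
  qed
  moreover have "Spl [:a, a, 0, 1:] \<subseteq> Spl [:b, b, 0, 1:]"
  proof (rule Spl_subset_if_roots_Moebius)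
    fix x assume "poly (map_poly to_ac [:a, a, 0, 1:]) x = 0"
    then have x: "x^3 + to_ac a * x + to_ac a = 0" unfolding poly_cubic .
    have nt: "x - to_ac t \<noteq> 0" using x F' by auto
    \<comment> \<open>The inverse of the Moebius map used for the other inclusion.\<close>
    define y where "y = (to_ac \<beta> - to_ac \<delta> * x) / (x - to_ac t)"
    have yx: "y * (x - to_ac t) = to_ac \<beta> - to_ac \<delta> * x" using nt by (simp add: y_def)
    have xZ: "to_ac t * y + to_ac \<beta> = x * (y + to_ac \<delta>)" using yx by (simp add: algebra_simps)
    have Z: "y + to_ac \<delta> \<noteq> 0"
    proof
      assume Z: "y + to_ac \<delta> = 0"
      moreover have "y = - to_ac \<delta>" using Z by (simp add: eq_neg_iff_add_eq_0)
      ultimately have "to_ac \<beta> - to_ac t * to_ac \<delta> = 0" using xZ by simp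
      with det' show False by contradiction
    qed
    have "(to_ac t ^ 3 + to_ac a * to_ac t + to_ac a) * (y^3 + to_ac b * y + to_ac b)
        = (x^3 + to_ac a * x + to_ac a) * (y + to_ac \<delta>)^3"
      unfolding subst[symmetric] xZ by (simp add: algebra_simps power2_eq_square power3_eq_cube)
    then have root: "y^3 + to_ac b * y + to_ac b = 0" using x F' by simp
    have "x = (to_ac t * y + to_ac \<beta>) / (to_ac 1 * y + to_ac \<delta>)" "to_ac 1 * y + to_ac \<delta> \<noteq> 0"
      using xZ Z by simp_all
    then show "\<exists>y p q r s. poly (map_poly to_ac [:b, b, 0, 1:]) y = 0 \<and>
        to_ac r * y + to_ac s \<noteq> 0 \<and> x = (to_ac p * y + to_ac q) / (to_ac r * y + to_ac s)"
      using root unfolding poly_cubic by blast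
  qed
  ultimately show ?thesis by (simp add: b_def)
qed

section \<open>Finite fibres and infinitely many parameters\<close>

text \<open>The difference of the two sides is a polynomial in \<open>t\<close> of degree 6 unless
  \<open>c = a\<close>; in that case its coefficient at \<open>t^5\<close> is
  \<open>3^5 * a * (4 * a + 27)\<close>, nonzero by the discriminant condition.\<close>

lemma finite_param_fibre:
  fixes a c :: "'a::field"
  assumes three: "(3 :: 'a) \<noteq> 0" and a: "a * (4 * a + 27) \<noteq> 0"
  shows "finite {t. 27 * a * hess a t ^ 3 = c * covar a t ^ 2}"
proof -
  define p where "p = smult (27 * a) ([:- a, 9, 3:] ^ 3) -
    smult c ([:27 * a + 2 * a^2, 27 * a, 18 * a, - 27:] ^ 2)"
  have "coeff p 6 = 3^6 * (a - c)" "coeff p 5 = 3^5 * a * (4 * c + 27)"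
    by (simp_all add: p_def power2_eq_square power3_eq_cube numeral_eq_Suc algebra_simps)
  then have "p \<noteq> 0"
    using power_not_zero[OF three, of 6] power_not_zero[OF three, of 5] a by (cases "c = a") auto
  moreover have "poly p t = 27 * a * hess a t ^ 3 - c * covar a t ^ 2" for t
    by (simp add: p_def hess_def covar_def algebra_simps power2_eq_square power3_eq_cube)
  ultimately show ?thesis
    using poly_roots_finite[of p] by simp
qed

theorem corollary4p11:
  fixes \<iota> :: "'k::field \<Rightarrow> 'm::field" and a :: 'm
  assumes "CHAR('k) \<noteq> 3"
    and "\<iota> \<in> ring_hom ring_of_type_algebra ring_of_type_algebra"
    and "hilbertian TYPE('m)"
    and "a * (4 * a + 27) \<noteq> 0"
  shows "infinite {b :: 'm. Spl [:a, a, 0, 1:] = Spl [:b, b, 0, 1:]}"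
proof
  assume fin: "finite {b :: 'm. Spl [:a, a, 0, 1:] = Spl [:b, b, 0, 1:]}" (is "finite ?B")
  have three: "(3 :: 'm) \<noteq> 0"
  proof
    assume "(3 :: 'm) = 0"
    then have "CHAR('m) dvd 3"
      using of_nat_eq_0_iff_char_dvd[where 'a = 'm, of 3] by simp
    moreover have "prime (3 :: nat)" by simp
    ultimately have "CHAR('m) = 3"
      unfolding prime_nat_iff by auto
    with CHAR_eq_if_ring_hom[OF assms(2)] assms(1) show False by simp
  qed
  have three27: "(27 :: 'm) \<noteq> 0"
    using power_not_zero[OF three, of 3] by simp
  define bad where "bad = {t. t^3 + a * t + a = 0} \<union> {t. hess a t = 0} \<union> {t. covar a t = 0}"
  define fib where "fib b = {t. 27 * a * hess a t ^ 3 = b * covar a t ^ 2}" for b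
  have "finite {t. t^3 + a * t + a = 0}"
    using poly_roots_finite[of "[:a, a, 0, 1:]"]
    by (simp add: algebra_simps power3_eq_cube)
  moreover have "finite {t. hess a t = 0}"
    using poly_roots_finite[of "[:- a, 9, 3:]"] three
    by (simp add: hess_def algebra_simps power2_eq_square)
  moreover have "finite {t. covar a t = 0}"
    using poly_roots_finite[of "[:27 * a + 2 * a^2, 27 * a, 18 * a, - 27:]"] three27
    by (simp add: covar_def algebra_simps power2_eq_square power3_eq_cube)
  ultimately have "finite bad"
    by (simp add: bad_def)
  moreover have "finite (\<Union>b\<in>?B. fib b)"
    using fin finite_param_fibre[OF three assms(4)] unfolding fib_def by (rule finite_UN_I)
  \<comment> \<open>Every \<open>t\<close> outside \<open>bad\<close> yields an admissible
    \<open>b\<close>, so finitely many \<open>b\<close> would leave only finitely many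
    \<open>t\<close>.\<close>
  moreover have "t \<in> bad \<union> (\<Union>b\<in>?B. fib b)" for t
  proof (cases "t \<in> bad")
    case False
    then have "param a t \<in> ?B"
      using Spl_param_eq[OF three, of t a] unfolding bad_def by blast
    moreover have "t \<in> fib (param a t)"
      using False by (simp add: bad_def fib_def param_def)
    ultimately show ?thesis by blast
  qed blast
  ultimately have "finite (UNIV :: 'm set)"
    by (meson UNIV_I finite_UnI finite_subset subsetI)
  with infinite_if_hilbertian[OF assms(3)] show False by contradiction
qed

end
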